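(* Fix integers $1\le j<i\le n$. For a map sending an input sequence $X=(\mathbf{x}_1,\dots,\mathbf{x}_n)\in(\mathbb{R}^d)^n$ to outputs $\mathbf{y}_1,\dots,\mathbf{y}_n\in\mathbb{R}^p$, let $J_{i,j}(X):=\partial\mathbf{y}_i/\partial\mathbf{x}_j\in\mathbb{R}^{p\times d}$ denote the Jacobian. (1) (Structured dynamics, linear SSM.) Let $\bar A\in\mathbb{R}^{s\times s}$, $\bar B\in\mathbb{R}^{s\times d}$, $C\in\mathbb{R}^{p\times s}$ and consider the map $$\mathbf{y}_i=\sum_{t=1}^{i}C\bar A^{\,i-t}\bar B\,\mathbf{x}_t,\qquad i=1,\dots,n.$$ Then for every input sequence $X$, $$J_{i,j}(X)=C\bar A^{\,i-j}\bar B\qquad\text{and}\qquad\|J_{i,j}(X)\|_2\le\|C\|_2\,\|\bar B\|_2\,\|\bar A\|_2^{\,i-j}.$$ In particular, if $\|\bar A\|_2<1$, then $\|J_{i,j}(X)\|_2$ decays exponentially in the distance $\tau=i-j$. (2) (Softmax attention.) Let $W_Q,W_K\in\mathbb{R}^{r\times d}$ and $V\in\mathbb{R}^{p\times d}$ be fixed matrices and consider the causal single-head softmax-attention layer $$\mathbf{y}_i=\sum_{t=1}^{i}\alpha_{it}(X)\,V\mathbf{x}_t,\qquad\alpha_{it}(X)=\frac{\exp(\mathbf{q}_i^\top\mathbf{k}_t)}{\sum_{s=1}^{i}\exp(\mathbf{q}_i^\top\mathbf{k}_s)},\qquad\mathbf{q}_i=W_Q\mathbf{x}_i,\quad\mathbf{k}_t=W_K\mathbf{x}_t.$$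 Assume that $\|V\|_2>0$ and that there exists $\mathbf{u}\in\mathbb{R}^d$ such that $W_K^\top W_Q\mathbf{u}\neq\mathbf{0}$. Then for every $\varepsilon>0$ there exists an input sequence $X$ (depending on $i,j,\varepsilon$) such that $$\|J_{i,j}(X)\|_2\ge\|V\|_2-\varepsilon.$$ In particular, this lower bound is independent of the distance $\tau=i-j$.
   Context: $\|\cdot\|_2$ denotes the spectral (operator) norm of a matrix. The Jacobian $\partial\mathbf{y}_i/\partial\mathbf{x}_j$ is the total derivative of $\mathbf{y}_i$ with respect to $\mathbf{x}_j$ with all other tokens held fixed; in part (2) it includes the dependence of the attention weights $\alpha_{it}(X)$ on $\mathbf{x}_j$. *)

theory Defs
  imports "HOL-Analysis.Analysis"
begin

text \<open>
  A sequence of \<open>n\<close> tokens in \<open>\<real>\<^sup>d\<close> is an element of the extensional function space over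
  \<open>{1..n}\<close>, so that tokens are indexed from 1 and \<open>n\<close> may be quantified over.
\<close>

definition token_seqs :: "nat \<Rightarrow> (nat \<Rightarrow> real ^ 'd) set" where
  "token_seqs n = {1..n} \<rightarrow>\<^sub>E UNIV"

definition spectral_norm :: "real ^ 'n ^ 'm \<Rightarrow> real" where
  "spectral_norm M = onorm ((*v) M)"

text \<open>The instance of \<open>(^)\<close> on \<open>real ^ 'n ^ 'n\<close> is the entrywise power, not the matrix power.\<close>

primrec matrix_power :: "real ^ 'n ^ 'n \<Rightarrow> nat \<Rightarrow> real ^ 'n ^ 'n" where
  "matrix_power M 0 = mat 1"
| "matrix_power M (Suc k) = M ** matrix_power M k"

text \<open>
  The Jacobian of the \<open>i\<close>-th output in the \<open>j\<close>-th token, all other tokens being held fixed. The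
  library's \<^const>\<open>jacobian\<close> is only meaningful where the map is differentiable, so differentiability
  is a separate predicate.
\<close>

definition token_differentiable ::
  "((nat \<Rightarrow> real ^ 'd) \<Rightarrow> nat \<Rightarrow> real ^ 'p) \<Rightarrow> (nat \<Rightarrow> real ^ 'd) \<Rightarrow> nat \<Rightarrow> nat \<Rightarrow> bool" where
  "token_differentiable F X i j \<longleftrightarrow> (\<lambda>x. F (X(j := x)) i) differentiable (at (X j))"

definition token_jacobian ::
  "((nat \<Rightarrow> real ^ 'd) \<Rightarrow> nat \<Rightarrow> real ^ 'p) \<Rightarrow> (nat \<Rightarrow> real ^ 'd) \<Rightarrow> nat \<Rightarrow> nat \<Rightarrow> real ^ 'd ^ 'p" where
  "token_jacobian F X i j = jacobian (\<lambda>x. F (X(j := x)) i) (at (X j))"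

definition ssm_output ::
  "real ^ 's ^ 's \<Rightarrow> real ^ 'd ^ 's \<Rightarrow> real ^ 's ^ 'p \<Rightarrow> (nat \<Rightarrow> real ^ 'd) \<Rightarrow> nat \<Rightarrow> real ^ 'p" where
  "ssm_output A B C X i = (\<Sum>t = 1..i. (C ** matrix_power A (i - t) ** B) *v X t)"

definition attention_weight ::
  "real ^ 'd ^ 'r \<Rightarrow> real ^ 'd ^ 'r \<Rightarrow> (nat \<Rightarrow> real ^ 'd) \<Rightarrow> nat \<Rightarrow> nat \<Rightarrow> real" where
  "attention_weight W\<^sub>Q W\<^sub>K X i t =
     exp ((W\<^sub>Q *v X i) \<bullet> (W\<^sub>K *v X t)) / (\<Sum>s = 1..i. exp ((W\<^sub>Q *v X i) \<bullet> (W\<^sub>K *v X s)))"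

definition attention_output ::
  "real ^ 'd ^ 'r \<Rightarrow> real ^ 'd ^ 'r \<Rightarrow> real ^ 'd ^ 'p \<Rightarrow> (nat \<Rightarrow> real ^ 'd) \<Rightarrow> nat \<Rightarrow> real ^ 'p" where
  "attention_output W\<^sub>Q W\<^sub>K V X i = (\<Sum>t = 1..i. attention_weight W\<^sub>Q W\<^sub>K X i t *\<^sub>R (V *v X t))"

end

theory Submission
  imports Defs "HOL-Real_Asymp.Real_Asymp"
begin

text \<open>
  The state space output is affine in each token, so its Jacobian is read off directly. For attention,
  fix all tokens except \<open>x = x\<^sub>j\<close>, put \<open>w = W\<^sub>K\<^sup>T W\<^sub>Q x\<^sub>i\<close>, and let \<open>D\<close> and \<open>N\<close> be the sums of the
  unnormalised weights, respectively weighted values, of the other tokens. Then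
  \<open>y\<^sub>i = V x + (N - D V x) / (e\<^bsup>w \<bullet> x\<^esup> + D)\<close>, and along \<open>x = \<lambda> w\<close> with \<open>\<lambda> \<rightarrow> \<infinity>\<close> the derivative of the
  second summand is \<open>O(\<lambda> e\<^bsup>-\<lambda> (w \<bullet> w)\<^esup>)\<close>, so the Jacobian tends to \<open>V\<close>.
\<close>

section \<open>Spectral norms of products and powers\<close>

lemma spectral_norm_nonneg: "0 \<le> spectral_norm M"
  unfolding spectral_norm_def by (rule onorm_pos_le[OF matrix_vector_mul_bounded_linear])

lemma norm_matrix_vector_le: "norm (M *v x) \<le> spectral_norm M * norm x"
  unfolding spectral_norm_def by (rule onorm[OF matrix_vector_mul_bounded_linear])

lemma spectral_norm_mult: "spectral_norm (M ** N) \<le> spectral_norm M * spectral_norm N"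
proof -
  have "(*v) (M ** N) = (*v) M \<circ> (*v) N"
    by (simp add: fun_eq_iff matrix_vector_mul_assoc)
  then show ?thesis
    unfolding spectral_norm_def
    using onorm_compose[OF matrix_vector_mul_bounded_linear matrix_vector_mul_bounded_linear, of M N] by simp
qed

lemma spectral_norm_matrix_power: "spectral_norm (matrix_power M k) \<le> spectral_norm M ^ k"
proof (induction k)
  case 0
  show ?case unfolding spectral_norm_def by (rule onorm_le) simp
next
  case (Suc k)
  have "spectral_norm (matrix_power M (Suc k)) \<le> spectral_norm M * spectral_norm (matrix_power M k)"
    by (simp add: spectral_norm_mult)
  also have "\<dots> \<le> spectral_norm M * spectral_norm M ^ k"
    by (intro mult_left_mono Suc.IH spectral_norm_nonneg)
  finally show ?case by simp
qed

section \<open>Jacobians in a single token and the linear state space model\<close>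

lemma token_jacobian_eq:
  assumes "((\<lambda>x. F (X(j := x)) i) has_derivative f') (at (X j))"
  shows "token_differentiable F X i j" "token_jacobian F X i j = matrix f'"
  \<comment> \<open>Uniqueness of the Frechet derivative identifies the one chosen inside
    \<open>jacobian\<close> with \<open>f'\<close>.\<close>
  using assms frechet_derivative_at[OF assms]
  by (auto simp: token_differentiable_def token_jacobian_def jacobian_def differentiable_def)

text \<open>Separates the replaced token from the fixed ones. The summand \<open>g\<close> takes the
  token and its position as two arguments because a coefficient may depend on the position, as the
  power of \<open>A\<close> does.\<close>

lemma sum_fun_upd_split:
  fixes g :: "'b \<Rightarrow> nat \<Rightarrow> 'a::comm_monoid_add"
  assumes "j \<in> {1..i}"
  shows "(\<Sum>t = 1..i. g ((X(j := x)) t) t) = g x j + (\<Sum>t \<in> {1..i} - {j}. g (X t) t)"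
  using assms by (simp add: sum.remove[of _ j])

lemma ssm_output_has_derivative:
  assumes "j \<in> {1..i}"
  shows "((\<lambda>x. ssm_output A B C (X(j := x)) i) has_derivative
    (*v) (C ** matrix_power A (i - j) ** B)) (at (X j))"
proof -
  have "(\<lambda>x. ssm_output A B C (X(j := x)) i) =
      (\<lambda>x. (C ** matrix_power A (i - j) ** B) *v x
        + (\<Sum>t \<in> {1..i} - {j}. (C ** matrix_power A (i - t) ** B) *v X t))"
    unfolding ssm_output_def
    using sum_fun_upd_split[OF assms, of "\<lambda>y t. (C ** matrix_power A (i - t) ** B) *v y"] by simp
  then show ?thesis
    by (auto intro!: derivative_eq_intros bounded_linear_imp_has_derivative matrix_vector_mul_bounded_linear)
qed

lemma ssm_jacobian:
  assumes "j \<in> {1..i}"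
  shows "token_differentiable (ssm_output A B C) X i j"
    and "token_jacobian (ssm_output A B C) X i j = C ** matrix_power A (i - j) ** B"
  using token_jacobian_eq[where F = "ssm_output A B C", OF ssm_output_has_derivative[OF assms]]
  by (simp_all add: matrix_of_matrix_vector_mul)

lemma ssm_jacobian_bound:
  assumes "j \<in> {1..i}"
  shows "spectral_norm (token_jacobian (ssm_output A B C) X i j)
    \<le> spectral_norm C * spectral_norm B * spectral_norm A ^ (i - j)"
proof -
  have "spectral_norm (C ** matrix_power A (i - j) ** B)
      \<le> spectral_norm (C ** matrix_power A (i - j)) * spectral_norm B"
    by (rule spectral_norm_mult)
  also have "\<dots> \<le> (spectral_norm C * spectral_norm A ^ (i - j)) * spectral_norm B"
    by (intro mult_right_mono spectral_norm_nonneg order_trans[OF spectral_norm_mult]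
        mult_left_mono spectral_norm_matrix_power)
  finally show ?thesis by (simp add: ssm_jacobian(2)[OF assms] mult_ac)
qed

lemma power_le_exp_decay:
  fixes a :: real
  assumes "0 \<le> a" "a < 1"
  obtains c where "c > 0" "\<And>k. a ^ k \<le> exp (- c * real k)"
proof
  \<comment> \<open>The floor 1/2 covers \<open>a = 0\<close>, where \<open>- ln a\<close> is not a
    positive rate.\<close>
  define b where "b = max a (1/2)"
  have b: "0 < b" "b < 1" "a \<le> b" using assms by (auto simp: b_def)
  show "- ln b > 0" using b by simp
  show "a ^ k \<le> exp (- (- ln b) * real k)" for k
    using power_mono[OF b(3) assms(1), of k] b by (simp add: exp_of_nat2_mult)
qed

section \<open>Causal softmax attention\<close>

lemma attention_output_fun_upd:
  fixes W\<^sub>Q W\<^sub>K :: "real ^ 'd ^ 'r" and V :: "real ^ 'd ^ 'p"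
    and X :: "nat \<Rightarrow> real ^ 'd"
  assumes "j \<in> {1..i}" "j \<noteq> i"
  defines "w \<equiv> (transpose W\<^sub>K ** W\<^sub>Q) *v X i"
  defines "D \<equiv> \<Sum>t \<in> {1..i} - {j}. exp (w \<bullet> X t)"
    and "N \<equiv> \<Sum>t \<in> {1..i} - {j}. exp (w \<bullet> X t) *\<^sub>R (V *v X t)"
  shows "attention_output W\<^sub>Q W\<^sub>K V (X(j := x)) i
    = V *v x + inverse (exp (w \<bullet> x) + D) *\<^sub>R (N - D *\<^sub>R (V *v x))"
proof -
  \<comment> \<open>Since \<open>j\<close> differs from \<open>i\<close>, replacing token
    \<open>j\<close> leaves the query alone: \<open>w\<close> is constant in \<open>x\<close>, and
    \<open>x\<close> enters only as a key and a value.\<close>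
  have score: "(W\<^sub>Q *v X i) \<bullet> (W\<^sub>K *v y) = w \<bullet> y" for y
    unfolding w_def
    by (metis dot_lmul_matrix matrix_vector_mul_assoc transpose_matrix_vector)
  have D: "D \<ge> 0" unfolding D_def by (simp add: sum_nonneg)
  then have pos: "exp (w \<bullet> x) + D > 0" by (simp add: add_pos_nonneg)
  have "attention_output W\<^sub>Q W\<^sub>K V (X(j := x)) i
      = inverse (exp (w \<bullet> x) + D) *\<^sub>R
        (\<Sum>t = 1..i. exp (w \<bullet> (X(j := x)) t) *\<^sub>R (V *v (X(j := x)) t))"
    using assms(2) sum_fun_upd_split[OF assms(1), of "\<lambda>y t. exp (w \<bullet> y)" X x]
    unfolding attention_output_def attention_weight_def
    by (simp add: score scaleR_sum_right D_def divide_inverse_commute)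
  also have "\<dots> = inverse (exp (w \<bullet> x) + D) *\<^sub>R (exp (w \<bullet> x) *\<^sub>R (V *v x) + N)"
    unfolding N_def
    by (subst sum_fun_upd_split[OF assms(1), of "\<lambda>y t. exp (w \<bullet> y) *\<^sub>R (V *v y)" X x]) simp
  \<comment> \<open>Adding and subtracting \<open>D *\<^sub>R (V *v x)\<close> creates the full
    normaliser as a factor; it cancels and leaves \<open>V *v x\<close> as the main term.\<close>
  also have "exp (w \<bullet> x) *\<^sub>R (V *v x) + N
      = (exp (w \<bullet> x) + D) *\<^sub>R (V *v x) + (N - D *\<^sub>R (V *v x))"
    by (simp add: algebra_simps)
  finally show ?thesis using pos by (simp add: scaleR_right_distrib del: fun_upd_apply)
qed

text \<open>Product rule on the correction term, where differentiating \<open>inverse\<close>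
  contributes the squared normaliser. The summand \<open>V *v h\<close> stays apart so that the rest
  can be estimated as an error.\<close>

lemma softmax_mix_has_derivative:
  fixes V :: "real ^ 'd ^ 'p" and w x :: "real ^ 'd" and N :: "real ^ 'p"
  assumes "D \<ge> 0"
  defines "E \<equiv> exp (w \<bullet> x)"
  shows "((\<lambda>x. V *v x + inverse (exp (w \<bullet> x) + D) *\<^sub>R (N - D *\<^sub>R (V *v x))) has_derivative
    (\<lambda>h. V *v h + (inverse (E + D) *\<^sub>R (- D *\<^sub>R (V *v h))
       - (inverse (E + D) * (E * (w \<bullet> h)) * inverse (E + D)) *\<^sub>R (N - D *\<^sub>R (V *v x))))) (at x)"
proof -
  have "exp (w \<bullet> x) + D \<noteq> 0"
    using assms(1) exp_gt_zero[of "w \<bullet> x"] by linarith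
  note [derivative_intros] = bounded_linear.has_derivative[OF matrix_vector_mul_bounded_linear]
  show ?thesis
    unfolding E_def
    by (rule derivative_eq_intros refl | fact | simp add: algebra_simps)+
qed

text \<open>One factor \<open>inverse (E + D)\<close> supplies the decay \<open>inverse E\<close>.
  In the second term the \<open>E\<close> that comes from differentiating the exponential is
  absorbed by the other such factor, so what multiplies \<open>inverse E\<close> is only affine in
  \<open>norm x\<close>.\<close>

lemma softmax_mix_error_bound:
  fixes V :: "real ^ 'd ^ 'p" and w x h :: "real ^ 'd" and N :: "real ^ 'p"
  assumes "D \<ge> 0" "E > 0"
  shows "norm (inverse (E + D) *\<^sub>R (- D *\<^sub>R (V *v h))
       - (inverse (E + D) * (E * (w \<bullet> h)) * inverse (E + D)) *\<^sub>R (N - D *\<^sub>R (V *v x)))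
    \<le> inverse E * (D * spectral_norm V + norm w * (norm N + D * spectral_norm V * norm x)) * norm h"
proof -
  have inv: "inverse (E + D) \<le> inverse E" "0 \<le> inverse (E + D)"
    using assms by (simp_all add: le_imp_inverse_le)
  have "norm (inverse (E + D) *\<^sub>R (- D *\<^sub>R (V *v h))) = inverse (E + D) * (D * norm (V *v h))"
    using assms by simp
  also have "\<dots> \<le> inverse E * (D * (spectral_norm V * norm h))"
    using assms inv by (intro mult_mono mult_left_mono norm_matrix_vector_le) auto
  finally have first: "norm (inverse (E + D) *\<^sub>R (- D *\<^sub>R (V *v h)))
    \<le> inverse E * (D * (spectral_norm V * norm h))" .
  have coeff: "inverse (E + D) * E \<le> 1"
    using assms by (simp add: field_simps)
  have "\<bar>inverse (E + D) * (E * (w \<bullet> h)) * inverse (E + D)\<bar>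
      = (inverse (E + D) * E) * \<bar>w \<bullet> h\<bar> * inverse (E + D)"
    using assms by (simp add: abs_mult)
  also have "\<dots> \<le> 1 * (norm w * norm h) * inverse E"
    using assms inv coeff by (intro mult_mono Cauchy_Schwarz_ineq2) auto
  finally have scalar: "\<bar>inverse (E + D) * (E * (w \<bullet> h)) * inverse (E + D)\<bar>
    \<le> norm w * norm h * inverse E" by simp
  have "norm (N - D *\<^sub>R (V *v x)) \<le> norm N + D * norm (V *v x)"
    using norm_triangle_ineq4[of N "D *\<^sub>R (V *v x)"] assms by simp
  also have "\<dots> \<le> norm N + D * (spectral_norm V * norm x)"
    using assms by (intro add_left_mono mult_left_mono norm_matrix_vector_le) auto
  finally have vec: "norm (N - D *\<^sub>R (V *v x)) \<le> norm N + D * (spectral_norm V * norm x)" .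
  have second: "norm ((inverse (E + D) * (E * (w \<bullet> h)) * inverse (E + D)) *\<^sub>R (N - D *\<^sub>R (V *v x)))
      \<le> (norm w * norm h * inverse E) * (norm N + D * (spectral_norm V * norm x))"
    unfolding norm_scaleR using assms by (intro mult_mono scalar vec) auto
  show ?thesis
    by (rule order_trans[OF norm_triangle_ineq4 order_trans[OF add_mono[OF first second]]])
      (simp add: algebra_simps)
qed

text \<open>Triangle inequality for \<open>V *v h = (V *v h + R h) - R h\<close>: a perturbation of
  operator norm at most \<epsilon> lowers the norm by at most \<epsilon>.\<close>

lemma spectral_norm_matrix_ge:
  fixes V :: "real ^ 'd ^ 'p"
  assumes "bounded_linear (\<lambda>h. V *v h + R h)" "\<And>h. norm (R h) \<le> \<epsilon> * norm h"
  shows "spectral_norm (matrix (\<lambda>h. V *v h + R h)) \<ge> spectral_norm V - \<epsilon>"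
proof -
  let ?J = "\<lambda>h. V *v h + R h"
  have J: "(*v) (matrix ?J) = ?J"
    by (rule matrix_vector_mul(3)[OF assms(1)])
  have "onorm ((*v) V) \<le> onorm ?J + \<epsilon>"
  proof (rule onorm_le)
    fix h
    have "norm (V *v h) \<le> norm (?J h) + norm (R h)"
      using norm_triangle_ineq4[of "?J h" "R h"] by simp
    also have "\<dots> \<le> onorm ?J * norm h + \<epsilon> * norm h"
      by (intro add_mono onorm assms)
    finally show "norm (V *v h) \<le> (onorm ?J + \<epsilon>) * norm h" by (simp add: algebra_simps)
  qed
  then show ?thesis by (simp add: spectral_norm_def J)
qed

text \<open>Exponential growth beats linear growth. The sign of \<open>t\<close> is recorded because
  \<open>t\<close> will scale a vector, whose norm must then be linear in \<open>t\<close>.\<close>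

lemma linear_times_exp_decay:
  fixes a b c \<epsilon> :: real
  assumes "c > 0" "\<epsilon> > 0"
  obtains t where "t \<ge> 0" "inverse (exp (t * c)) * (a + b * t) \<le> \<epsilon>"
proof -
  have "((\<lambda>t. inverse (exp (t * c)) * (a + b * t)) \<longlongrightarrow> 0) at_top"
    using assms(1) by real_asymp
  then have "\<forall>\<^sub>F t in at_top. inverse (exp (t * c)) * (a + b * t) < \<epsilon>"
    using assms(2) by (rule order_tendstoD)
  then have "\<forall>\<^sub>F t in at_top. t \<ge> 0 \<and> inverse (exp (t * c)) * (a + b * t) < \<epsilon>"
    by (intro eventually_conj eventually_ge_at_top)
  then obtain t where "t \<ge> 0" "inverse (exp (t * c)) * (a + b * t) < \<epsilon>"
    using eventually_happens'[OF trivial_limit_at_top_linorder] by blast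
  then show ?thesis using that by simp
qed

lemma attention_jacobian_near_V:
  fixes W\<^sub>Q W\<^sub>K :: "real ^ 'd ^ 'r" and V :: "real ^ 'd ^ 'p"
  assumes ij: "1 \<le> j" "j < i" "i \<le> n" and u: "(transpose W\<^sub>K ** W\<^sub>Q) *v u \<noteq> 0" and "\<epsilon> > 0"
  obtains X where "X \<in> token_seqs n"
    and "token_differentiable (attention_output W\<^sub>Q W\<^sub>K V) X i j"
    and "spectral_norm (token_jacobian (attention_output W\<^sub>Q W\<^sub>K V) X i j) \<ge> spectral_norm V - \<epsilon>"
proof -
  define w where "w = (transpose W\<^sub>K ** W\<^sub>Q) *v u"
  \<comment> \<open>Background sequence: token \<open>i\<close> is \<open>u\<close>, so its query
    yields the nonzero direction \<open>w\<close>. As \<open>D\<close> and \<open>N\<close> leave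
    out token \<open>j\<close>, the scale \<open>l\<close> of that token can be chosen after
    them.\<close>
  define Y where "Y = (\<lambda>t. if t = i then u else 0)"
  define D where "D = (\<Sum>t \<in> {1..i} - {j}. exp (w \<bullet> Y t))"
  define N where "N = (\<Sum>t \<in> {1..i} - {j}. exp (w \<bullet> Y t) *\<^sub>R (V *v Y t))"
  have "D \<ge> 0" unfolding D_def by (simp add: sum_nonneg)
  \<comment> \<open>This is the coefficient of \<open>norm h\<close> in the error bound at
    \<open>x = l *\<^sub>R w\<close>, sorted by powers of \<open>l\<close>. The exponent grows with
    \<open>l\<close> because \<open>w\<close> is nonzero.\<close>
  obtain l where l: "l \<ge> 0" "inverse (exp (l * (w \<bullet> w))) * ((D * spectral_norm V + norm w * norm N)
      + (norm w * D * spectral_norm V * norm w) * l) \<le> \<epsilon>"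
    using linear_times_exp_decay[of "w \<bullet> w" \<epsilon>] u \<open>\<epsilon> > 0\<close> unfolding w_def by (metis inner_gt_zero_iff)
  \<comment> \<open>Token \<open>i\<close> stays \<open>u\<close> since \<open>j < i\<close>;
    \<open>restrict\<close> sets the value \<open>undefined\<close> outside \<open>{1..n}\<close>,
    as the extensional space demands.\<close>
  define X where "X = restrict (Y(j := l *\<^sub>R w)) {1..n}"
  have X: "X j = l *\<^sub>R w" "X i = u" using ij by (auto simp: X_def Y_def)
  have XY: "X t = Y t" if "t \<in> {1..i} - {j}" for t using that ij by (auto simp: X_def)
  have out: "attention_output W\<^sub>Q W\<^sub>K V (X(j := x)) i
      = V *v x + inverse (exp (w \<bullet> x) + D) *\<^sub>R (N - D *\<^sub>R (V *v x))" for x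
    using attention_output_fun_upd[of j i W\<^sub>Q W\<^sub>K V X x] ij
    unfolding D_def N_def by (simp add: X XY del: fun_upd_apply flip: w_def)
  define E where "E = exp (w \<bullet> X j)"
  define R where "R = (\<lambda>h. inverse (E + D) *\<^sub>R (- D *\<^sub>R (V *v h))
       - (inverse (E + D) * (E * (w \<bullet> h)) * inverse (E + D)) *\<^sub>R (N - D *\<^sub>R (V *v X j)))"
  have deriv: "((\<lambda>x. attention_output W\<^sub>Q W\<^sub>K V (X(j := x)) i) has_derivative (\<lambda>h. V *v h + R h)) (at (X j))"
    unfolding out R_def E_def using \<open>D \<ge> 0\<close> by (rule softmax_mix_has_derivative)
  have "norm (R h) \<le> \<epsilon> * norm h" for h
  proof -
    have "norm (R h) \<le> inverse E * (D * spectral_norm V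
        + norm w * (norm N + D * spectral_norm V * norm (X j))) * norm h"
      unfolding R_def by (rule softmax_mix_error_bound[OF \<open>D \<ge> 0\<close>]) (simp add: E_def)
    also have "\<dots> \<le> \<epsilon> * norm h"
      using l by (intro mult_right_mono) (simp_all add: E_def X algebra_simps)
    finally show ?thesis .
  qed
  then have "spectral_norm (matrix (\<lambda>h. V *v h + R h)) \<ge> spectral_norm V - \<epsilon>"
    by (intro spectral_norm_matrix_ge has_derivative_bounded_linear[OF deriv])
  moreover have "X \<in> token_seqs n"
    by (simp add: X_def token_seqs_def PiE_iff)
  ultimately show ?thesis
    using that token_jacobian_eq[where F = "attention_output W\<^sub>Q W\<^sub>K V", OF deriv] by simp
qed

theorem theorem5p1:
  fixes A :: "real ^ 's ^ 's" and B :: "real ^ 'd ^ 's" and C :: "real ^ 's ^ 'p"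
    and W\<^sub>Q W\<^sub>K :: "real ^ 'd ^ 'r" and V :: "real ^ 'd ^ 'p"
  shows
    "(\<forall>n i j. 1 \<le> j \<and> j < i \<and> i \<le> n \<longrightarrow>
        (\<forall>X \<in> token_seqs n.
           token_differentiable (ssm_output A B C) X i j \<and>
           token_jacobian (ssm_output A B C) X i j = C ** matrix_power A (i - j) ** B \<and>
           spectral_norm (token_jacobian (ssm_output A B C) X i j)
             \<le> spectral_norm C * spectral_norm B * spectral_norm A ^ (i - j)))
     \<and> (spectral_norm A < 1 \<longrightarrow>
         (\<exists>K \<ge> 0. \<exists>c > 0. \<forall>n i j. 1 \<le> j \<and> j < i \<and> i \<le> n \<longrightarrow>
            (\<forall>X \<in> token_seqs n.
               spectral_norm (token_jacobian (ssm_output A B C) X i j) \<le> K * exp (- c * real (i - j)))))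
     \<and> (spectral_norm V > 0 \<and> (\<exists>u. (transpose W\<^sub>K ** W\<^sub>Q) *v u \<noteq> 0) \<longrightarrow>
         (\<forall>n i j. 1 \<le> j \<and> j < i \<and> i \<le> n \<longrightarrow>
            (\<forall>\<epsilon> > 0. \<exists>X \<in> token_seqs n.
               token_differentiable (attention_output W\<^sub>Q W\<^sub>K V) X i j \<and>
               spectral_norm (token_jacobian (attention_output W\<^sub>Q W\<^sub>K V) X i j)
                 \<ge> spectral_norm V - \<epsilon>)))"
proof (intro conjI impI allI ballI; (elim conjE)?)
  fix n i j :: nat and X :: "nat \<Rightarrow> real ^ 'd"
  assume "1 \<le> j" "j < i" "i \<le> n"
  then have j: "j \<in> {1..i}" by simp
  show "token_differentiable (ssm_output A B C) X i j"
    and "token_jacobian (ssm_output A B C) X i j = C ** matrix_power A (i - j) ** B"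
    and "spectral_norm (token_jacobian (ssm_output A B C) X i j)
      \<le> spectral_norm C * spectral_norm B * spectral_norm A ^ (i - j)"
    by (rule ssm_jacobian[OF j] ssm_jacobian_bound[OF j])+
next
  assume "spectral_norm A < 1"
  then obtain c where c: "c > 0" "\<And>k. spectral_norm A ^ k \<le> exp (- c * real k)"
    using power_le_exp_decay[OF spectral_norm_nonneg] by metis
  \<comment> \<open>Both \<open>?K\<close> and the rate \<open>c\<close> come from the matrices
    alone, so the decay is uniform in \<open>n\<close>, \<open>i\<close>, \<open>j\<close> and
    \<open>X\<close>.\<close>
  let ?K = "spectral_norm C * spectral_norm B"
  have K: "?K \<ge> 0" by (simp add: spectral_norm_nonneg)
  have "spectral_norm (token_jacobian (ssm_output A B C) X i j) \<le> ?K * exp (- c * real (i - j))"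
    if "1 \<le> j" "j < i" for i j X
    using that
    by (intro order_trans[OF ssm_jacobian_bound mult_left_mono[OF c(2) K]]) simp
  with K c(1) show "\<exists>K \<ge> 0. \<exists>c > 0. \<forall>n i j. 1 \<le> j \<and> j < i \<and> i \<le> n \<longrightarrow>
      (\<forall>X \<in> token_seqs n.
         spectral_norm (token_jacobian (ssm_output A B C) X i j) \<le> K * exp (- c * real (i - j)))"
    by blast
next
  fix n i j :: nat and \<epsilon> :: real
  assume "\<exists>u. (transpose W\<^sub>K ** W\<^sub>Q) *v u \<noteq> 0" "1 \<le> j" "j < i" "i \<le> n" "\<epsilon> > 0"
  then show "\<exists>X \<in> token_seqs n.
      token_differentiable (attention_output W\<^sub>Q W\<^sub>K V) X i j \<and>
      spectral_norm (token_jacobian (attention_output W\<^sub>Q W\<^sub>K V) X i j) \<ge> spectral_norm V - \<epsilon>"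
    using attention_jacobian_near_V[where V = V] by metis
qed

end
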